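(* For every integer $n\ge 2$ there exist unique integers $a=a(n)$, $b=b(n)$, $t=t(n)$ with $n=af_t+bf_{t-1}$, $t\ge 2$ and $1\le a\le b\le f_t$. Moreover: (i) $(b,a)$ is $n$-good, $s(n)=t+1$, and, writing $s=s(n)$, we have $w_{s+1}(b,a)=\lfloor \phi n\rfloor$ if $t$ is even and $w_{s+1}(b,a)=\lceil \phi n\rceil$ if $t$ is odd. (ii) If $a\le f_{t-1}$, then $(b,a)$ is the unique $n$-good pair. Otherwise, the only other $n$-good pair is $(b',a')=(b+f_t,\,a-f_{t-1})$, and $w_{s+1}(b',a')=\lfloor\phi n\rfloor-1$ if $t$ is even and $w_{s+1}(b',a')=\lceil\phi n\rceil+1$ if $t$ is odd.
   Context: $f_k$ denotes the Fibonacci numbers, $f_1=f_2=1$, $f_{k+2}=f_{k+1}+f_k$ (with $f_0=0$, $f_{-1}=1$), and $\phi=(1+\sqrt5)/2$. For positive integers $a_1,a_2$, the $(a_1,a_2)$-Fibonacci walk is the sequence $w_k=w_k(a_1,a_2)$ with $w_1=a_1$, $w_2=a_2$, $w_{k+2}=w_{k+1}+w_k$ for $k\ge1$. Let $s(n;a_1,a_2)$ be the integer $s$ with $w_s(a_1,a_2)=n$ (and $-\infty$ if none exists), and $s(n)=\max_{a_1,a_2\ge1}s(n;a_1,a_2)$. A pair $(a_1,a_2)$ is $n$-good if $a_1,a_2\ge1$ and $s(n;a_1,a_2)=s(n)$. *)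

theory Defs
  imports Complex_Main "HOL-Library.Extended" "HOL-Number_Theory.Fib"
begin

definition golden :: real where
  "golden = (1 + sqrt 5) / 2"

text \<open>
  The walk is indexed from 1. The value at index 0 continues the recurrence backwards; it is
  not part of the walk, and \<^term>\<open>k \<ge> 1\<close> is required wherever indices are searched for.
\<close>

fun fib_walk :: "int \<Rightarrow> int \<Rightarrow> nat \<Rightarrow> int" where
  "fib_walk a1 a2 0 = a2 - a1"
| "fib_walk a1 a2 (Suc 0) = a1"
| "fib_walk a1 a2 (Suc (Suc 0)) = a2"
| "fib_walk a1 a2 (Suc (Suc (Suc k))) = fib_walk a1 a2 (Suc (Suc k)) + fib_walk a1 a2 (Suc k)"

text \<open>
  The index of \<open>n\<close> in a walk with positive start values is unique, except that \<open>n\<close> has the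
  indices 1 and 2 if both start values are \<open>n\<close> (see \<open>fib_walk_index_unique\<close>). In that case the
  larger index is taken.
\<close>

definition walk_steps :: "int \<Rightarrow> int \<Rightarrow> int \<Rightarrow> nat extended" where
  "walk_steps n a1 a2 =
     (if \<exists>s\<ge>1. fib_walk a1 a2 s = n
      then Fin (GREATEST s. s \<ge> 1 \<and> fib_walk a1 a2 s = n)
      else Minf)"

definition max_steps :: "int \<Rightarrow> nat extended" where
  "max_steps n = Max {walk_steps n a1 a2 | a1 a2. a1 \<ge> 1 \<and> a2 \<ge> 1}"

definition n_good :: "int \<Rightarrow> int \<times> int \<Rightarrow> bool" where
  "n_good n p \<longleftrightarrow> fst p \<ge> 1 \<and> snd p \<ge> 1 \<and> walk_steps n (fst p) (snd p) = max_steps n"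

definition slow_rep :: "int \<Rightarrow> int \<Rightarrow> int \<Rightarrow> nat \<Rightarrow> bool" where
  "slow_rep n a b t \<longleftrightarrow>
     n = a * int (fib t) + b * int (fib (t - 1)) \<and> t \<ge> 2 \<and> 1 \<le> a \<and> a \<le> b \<and> b \<le> int (fib t)"

lemma fib_walk_pos:
  assumes "a1 \<ge> 1" "a2 \<ge> 1" "s \<ge> 1"
  shows "fib_walk a1 a2 s \<ge> 1"
  using assms by (induction a1 a2 s rule: fib_walk.induct) auto

lemma fib_walk_ge:
  assumes "a1 \<ge> 1" "a2 \<ge> 1" "s \<ge> 1"
  shows "int s \<le> fib_walk a1 a2 s + 1"
  using assms
proof (induction a1 a2 s rule: fib_walk.induct)
  case (4 a1 a2 k)
  then show ?case using fib_walk_pos[of a1 a2 "Suc k"] by simp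
qed auto

lemma fib_walk_mono:
  assumes "a1 \<ge> 1" "a2 \<ge> 1" "2 \<le> r" "r < s"
  shows "fib_walk a1 a2 r < fib_walk a1 a2 s"
proof -
  have step: "fib_walk a1 a2 k < fib_walk a1 a2 (Suc k)" if k: "2 \<le> k" for k
  proof -
    from k obtain m where "k = Suc (Suc m)"
      by (metis add_2_eq_Suc le_Suc_ex)
    then show ?thesis using fib_walk_pos[OF assms(1,2), of "Suc m"] by simp
  qed
  from \<open>r < s\<close> \<open>2 \<le> r\<close> show ?thesis
  proof (induction s)
    case (Suc s)
    then show ?case using step[of s] by (cases "r = s") force+
  qed simp
qed

lemma fib_walk_index_unique:
  assumes "a1 \<ge> 1" "a2 \<ge> 1" "1 \<le> r" "r < s"
    and "fib_walk a1 a2 r = n" "fib_walk a1 a2 s = n"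
  shows "r = 1 \<and> s = 2 \<and> a1 = n \<and> a2 = n"
proof -
  have r: "r = 1"
    using fib_walk_mono[of a1 a2 r s] assms by fastforce
  have "s = 2"
  proof (rule ccontr)
    assume "s \<noteq> 2"
    with assms r have "s \<ge> 3" by simp
    moreover have "fib_walk a1 a2 3 = a2 + a1"
      by (simp add: numeral_3_eq_3)
    ultimately have "a2 + a1 \<le> fib_walk a1 a2 s"
      using fib_walk_mono[of a1 a2 3 s] assms by (cases "s = 3") auto
    then show False using assms r by simp
  qed
  moreover have "a1 = n"
    using assms(5) unfolding r by simp
  moreover have "a2 = n"
    using assms(6) unfolding \<open>s = 2\<close> by (simp add: numeral_2_eq_2)
  ultimately show ?thesis using r by blast
qed

text \<open>The next lemma makes the maximum in \<open>max_steps\<close> a maximum over a finite set.\<close>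

lemma finite_walk_steps:
  "finite {walk_steps n a1 a2 | a1 a2. a1 \<ge> 1 \<and> a2 \<ge> 1}"
proof (rule finite_subset)
  show "{walk_steps n a1 a2 | a1 a2. a1 \<ge> 1 \<and> a2 \<ge> 1} \<subseteq> insert Minf (Fin ` {..nat (n + 1)})"
  proof clarify
    fix a1 a2 :: int
    assume pos: "a1 \<ge> 1" "a2 \<ge> 1" and notin: "walk_steps n a1 a2 \<notin> Fin ` {..nat (n + 1)}"
    have bound: "s \<le> nat (n + 1)" if "s \<ge> 1 \<and> fib_walk a1 a2 s = n" for s
      using fib_walk_ge[OF pos, of s] that by linarith
    show "walk_steps n a1 a2 = Minf"
    proof (rule ccontr)
      assume "walk_steps n a1 a2 \<noteq> Minf"
      then have ex: "\<exists>s\<ge>1. fib_walk a1 a2 s = n"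
        by (auto simp: walk_steps_def split: if_splits)
      then obtain s0 where s0: "s0 \<ge> 1 \<and> fib_walk a1 a2 s0 = n" by blast
      have "(GREATEST s. s \<ge> 1 \<and> fib_walk a1 a2 s = n) \<le> nat (n + 1)"
        using bound GreatestI_nat[of "\<lambda>s. s \<ge> 1 \<and> fib_walk a1 a2 s = n", OF s0 bound] by blast
      with ex notin show False by (auto simp: walk_steps_def)
    qed
  qed
qed simp

end

theory Submission
  imports Defs
begin

text \<open>
  The representations \<open>n = a f\<^sub>t + b f\<^bsub>t-1\<^esub>\<close> at a fixed level \<open>t\<close> form one orbit under the shift
  \<open>(a, b) \<mapsto> (a - f\<^bsub>t-1\<^esub>, b + f\<^sub>t)\<close>, and a walk \<open>(b, a)\<close> can be prolonged backwards exactly if \<open>a > b\<close>.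
  Hence at the maximal level every positive representation satisfies \<open>a \<le> b\<close>, and the one with
  least \<open>b\<close> is slow. Conversely, if the level has a slow representation, all others with positive \<open>b\<close>
  have smaller \<open>a\<close> and larger \<open>b\<close>, so none of them can be prolonged. The term following \<open>n\<close> differs
  from \<open>\<phi> n\<close> by \<open>\<psi>\<^bsup>t-1\<^esup> (b + a \<psi>)\<close> with \<open>\<psi> = 1 - \<phi>\<close>, which lies strictly between \<open>-1\<close> and \<open>1\<close>.
\<close>

section \<open>Walks as linear forms in two consecutive terms, and representations at a fixed
  level\<close>

lemma fib_walk_shift:
  "fib_walk c d (Suc k + Suc i) =
    fib_walk c d (Suc (Suc k)) * int (fib (Suc i)) + fib_walk c d (Suc k) * int (fib i)"
proof (induction i rule: fib.induct)
  case (3 i)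
  have "fib_walk c d (Suc k + Suc (Suc (Suc i))) =
      fib_walk c d (Suc k + Suc (Suc i)) + fib_walk c d (Suc k + Suc i)"
    by simp
  then show ?case using 3 by (simp add: algebra_simps)
qed simp_all

lemma fib_walk_eq:
  assumes "t \<ge> 1"
  shows "fib_walk c d (t + 1) = d * int (fib t) + c * int (fib (t - 1))"
  using fib_walk_shift[of c d 0 "t - 1"] assms by simp

text \<open>Consecutive Fibonacci numbers are coprime, so two representations at one level differ by
  a multiple \<open>k\<close> of the shift. A negative \<open>k\<close> would give
  \<open>B \<le> b - int (fib t) \<le> 0\<close>.\<close>

lemma level_shift:
  fixes a b A B :: int
  assumes eq: "A * int (fib t) + B * int (fib (t - 1)) = a * int (fib t) + b * int (fib (t - 1))"
    and t: "t \<ge> 2" and b: "b \<le> int (fib t)" and B: "B \<ge> 1"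
  obtains k where "k \<ge> 0" "B = b + k * int (fib t)" "A = a - k * int (fib (t - 1))"
proof -
  have pos: "int (fib t) > 0" using t by (simp add: fib_neq_0_nat)
  have cop: "coprime (int (fib t)) (int (fib (t - 1)))"
    using coprime_fib_Suc_nat[of "t - 1"] t by (simp add: coprime_commute)
  have d: "(B - b) * int (fib (t - 1)) = (a - A) * int (fib t)"
    using eq by (simp add: algebra_simps)
  then have "int (fib t) dvd B - b"
    using cop by (metis coprime_dvd_mult_left_iff dvd_triv_right)
  then obtain k where k: "B - b = int (fib t) * k" ..
  then have "int (fib t) * (k * int (fib (t - 1))) = int (fib t) * (a - A)"
    using d by (simp add: algebra_simps)
  then have "k * int (fib (t - 1)) = a - A" using pos by simp
  moreover have "k \<ge> 0"
  proof (rule ccontr)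
    assume "\<not> k \<ge> 0"
    then have "int (fib t) * (k + 1) \<le> 0"
      using pos by (simp add: mult_nonneg_nonpos)
    with k b B show False by (simp add: algebra_simps)
  qed
  ultimately show thesis using that[of k] k by (simp add: algebra_simps)
qed

section \<open>The maximal index and the walks that attain it\<close>

lemma slow_rep_bounds_index:
  assumes rep: "slow_rep n a b t" and c: "c \<ge> 1" "d \<ge> 1" and s: "fib_walk c d s = n"
  shows "s \<le> t + 1"
proof (rule ccontr)
  assume "\<not> s \<le> t + 1"
  with rep obtain k i where k: "s = Suc (Suc k) + Suc i" "t = Suc i"
    unfolding slow_rep_def
    by (metis One_nat_def Suc_eq_plus1 Suc_leD add.commute add_Suc_right less_iff_Suc_add
        not_le_imp_less not_numeral_le_zero numeral_2_eq_2 old.nat.exhaust)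
  \<comment> \<open>\<open>B\<close> and \<open>A\<close> have the indices \<open>s - t\<close> and
    \<open>s - t + 1\<close>. As \<open>s - t \<ge> 2\<close>, they lie where the walk strictly
    increases, whereas the shift forces \<open>A \<le> a \<le> b \<le> B\<close>.\<close>
  define A where "A = fib_walk c d (Suc (Suc (Suc k)))"
  define B where "B = fib_walk c d (Suc (Suc k))"
  have "n = A * int (fib t) + B * int (fib (t - 1))"
    using fib_walk_shift[of c d "Suc k" i] s k unfolding A_def B_def by simp
  moreover have "B \<ge> 1" unfolding B_def by (rule fib_walk_pos[OF c]) simp
  ultimately obtain k' where "k' \<ge> 0" "B = b + k' * int (fib t)" "A = a - k' * int (fib (t - 1))"
    using level_shift[of A t B a b] rep unfolding slow_rep_def by metis
  then have "A \<le> a" "b \<le> B" by simp_all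
  moreover have "B < A" unfolding A_def B_def by (rule fib_walk_mono[OF c]) simp_all
  ultimately show False using rep unfolding slow_rep_def by linarith
qed

lemma slow_rep_walk_steps:
  assumes rep: "slow_rep n a b t" and c: "c \<ge> 1" "d \<ge> 1"
  shows "walk_steps n c d \<le> Fin (t + 1)"
    and "walk_steps n c d = Fin (t + 1) \<longleftrightarrow> n = d * int (fib t) + c * int (fib (t - 1))"
proof -
  let ?P = "\<lambda>s. s \<ge> 1 \<and> fib_walk c d s = n"
  have bound: "s \<le> t + 1" if "?P s" for s
    using slow_rep_bounds_index[OF rep c] that by blast
  have great: "?P (Greatest ?P)" if "\<exists>s. ?P s"
    using that bound by (metis (mono_tags, lifting) GreatestI_nat)
  show "walk_steps n c d \<le> Fin (t + 1)"
    using great bound unfolding walk_steps_def by auto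
  have t: "t \<ge> 1" using rep unfolding slow_rep_def by simp
  have "walk_steps n c d = Fin (t + 1) \<longleftrightarrow> ?P (t + 1)"
  proof
    assume "walk_steps n c d = Fin (t + 1)"
    then have "\<exists>s. ?P s" "Greatest ?P = t + 1"
      unfolding walk_steps_def by (auto split: if_splits)
    then show "?P (t + 1)" using great by metis
  next
    assume P: "?P (t + 1)"
    then have "Greatest ?P = t + 1"
      using bound by (intro Greatest_equality) auto
    with P show "walk_steps n c d = Fin (t + 1)"
      unfolding walk_steps_def by auto
  qed
  then show "walk_steps n c d = Fin (t + 1) \<longleftrightarrow> n = d * int (fib t) + c * int (fib (t - 1))"
    using fib_walk_eq[OF t, of c d] by auto
qed

text \<open>The bound is attained by the walk \<open>(b, a)\<close>, whose term at
  \<open>t + 1\<close> is the given representation.\<close>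

lemma slow_rep_max_steps:
  assumes rep: "slow_rep n a b t"
  shows "max_steps n = Fin (t + 1)"
  unfolding max_steps_def
proof (rule Max_eqI)
  show "finite {walk_steps n a1 a2 | a1 a2. a1 \<ge> 1 \<and> a2 \<ge> 1}" by (rule finite_walk_steps)
  show "y \<le> Fin (t + 1)" if "y \<in> {walk_steps n a1 a2 | a1 a2. a1 \<ge> 1 \<and> a2 \<ge> 1}" for y
    using that slow_rep_walk_steps(1)[OF rep] by blast
  have "a \<ge> 1" "b \<ge> 1" "n = a * int (fib t) + b * int (fib (t - 1))"
    using rep unfolding slow_rep_def by auto
  then have "walk_steps n b a = Fin (t + 1)"
    using slow_rep_walk_steps(2)[OF rep, of b a] by simp
  with \<open>a \<ge> 1\<close> \<open>b \<ge> 1\<close>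
  show "Fin (t + 1) \<in> {walk_steps n a1 a2 | a1 a2. a1 \<ge> 1 \<and> a2 \<ge> 1}"
    by (metis (mono_tags, lifting) mem_Collect_eq)
qed

lemma slow_rep_n_good_iff:
  assumes "slow_rep n a b t"
  shows "n_good n (B, A) \<longleftrightarrow>
    B \<ge> 1 \<and> A \<ge> 1 \<and> n = A * int (fib t) + B * int (fib (t - 1))"
  using slow_rep_walk_steps(2)[OF assms, of B A] slow_rep_max_steps[OF assms]
  unfolding n_good_def by auto

section \<open>Existence and uniqueness of the slow representation\<close>

lemma slow_rep_exists:
  fixes n :: int
  assumes "n \<ge> 2"
  shows "\<exists>a b t. slow_rep n a b t"
proof -
  \<comment> \<open>The coefficient \<open>b\<close> is a natural number so that a least one can be
    chosen below.\<close>
  define P where "P t \<longleftrightarrow> t \<ge> 2 \<and>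
    (\<exists>a b. a \<ge> 1 \<and> b \<ge> 1 \<and> n = a * int (fib t) + int b * int (fib (t - 1)))" for t :: nat
  have "P 2" unfolding P_def
    using assms by (auto simp: numeral_2_eq_2 intro!: exI[of _ "n - 1"] exI[of _ "1::nat"])
  \<comment> \<open>\<open>n\<close> is the term at \<open>t + 1\<close> of a positive walk, and a
    term at index \<open>s\<close> is at least \<open>s - 1\<close>.\<close>
  moreover have bound: "t \<le> nat n" if "P t" for t
  proof -
    from that obtain a b where ab: "a \<ge> 1" "int b \<ge> 1" "t \<ge> 1"
      "n = a * int (fib t) + int b * int (fib (t - 1))"
      unfolding P_def by auto
    then show ?thesis
      using fib_walk_ge[of "int b" a "t + 1"] fib_walk_eq[of t "int b" a] by linarith
  qed
  ultimately have Pt: "P (Greatest P)" and max: "\<And>t. P t \<Longrightarrow> t \<le> Greatest P"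
    by (blast intro: GreatestI_nat Greatest_le_nat)+
  define t where "t = Greatest P"
  define Q where "Q b \<longleftrightarrow> b \<ge> 1 \<and>
    (\<exists>a. a \<ge> 1 \<and> n = a * int (fib t) + int b * int (fib (t - 1)))" for b :: nat
  from Pt have t: "t \<ge> 2" and "\<exists>b. Q b" unfolding P_def Q_def t_def by auto
  then have Qb: "Q (Least Q)" and min: "\<And>b. Q b \<Longrightarrow> Least Q \<le> b"
    by (auto intro: LeastI_ex Least_le)
  define b where "b = Least Q"
  from Qb obtain a where a: "b \<ge> 1" "a \<ge> 1" and n: "n = a * int (fib t) + int b * int (fib (t - 1))"
    unfolding Q_def b_def by auto
  have "b \<le> fib t"
  proof (rule ccontr)
    assume gt: "\<not> b \<le> fib t"
    \<comment> \<open>Undoing one shift lowers \<open>b\<close> and raises \<open>a\<close>, against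
      the minimality of \<open>b\<close>.\<close>
    have "Q (b - fib t)" unfolding Q_def
    proof (intro conjI exI[of _ "a + int (fib (t - 1))"])
      show "n = (a + int (fib (t - 1))) * int (fib t) + int (b - fib t) * int (fib (t - 1))"
        using gt n by (simp add: of_nat_diff algebra_simps)
    qed (use gt a in auto)
    then have "b \<le> b - fib t" unfolding b_def by (rule min)
    moreover have "fib t > 0" using t by (simp add: fib_neq_0_nat)
    ultimately show False using gt by linarith
  qed
  moreover have "a \<le> int b"
  proof (rule ccontr)
    assume gt: "\<not> a \<le> int b"
    obtain i where i: "t = Suc i" using t by (cases t) auto
    \<comment> \<open>Prolonging the walk backwards gives the start values
      \<open>(a - b, b)\<close>, from which \<open>n\<close> is reached one index later, against the
      maximality of \<open>t\<close>.\<close>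
    have "P (Suc t)" unfolding P_def
    proof (intro conjI exI[of _ "int b"] exI[of _ "nat (a - int b)"])
      show "n = int b * int (fib (Suc t)) + int (nat (a - int b)) * int (fib (Suc t - 1))"
        using gt n i by (simp add: algebra_simps)
    qed (use gt a t in auto)
    then show False using max[of "Suc t"] unfolding t_def by simp
  qed
  ultimately have "slow_rep n a (int b) t"
    unfolding slow_rep_def using a t n by simp
  then show ?thesis by blast
qed

text \<open>The levels agree because each determines \<open>max_steps n\<close>. Then
  \<open>level_shift\<close>, used in both directions, gives two nonnegative shifts that
  cancel.\<close>

lemma slow_rep_unique:
  assumes r: "slow_rep n a b t" and r': "slow_rep n a' b' t'"
  shows "a' = a \<and> b' = b \<and> t' = t"
proof -
  have "t' = t" using slow_rep_max_steps[OF r] slow_rep_max_steps[OF r'] by simp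
  with r' have r': "slow_rep n a' b' t" by simp
  obtain k where k: "k \<ge> 0" "b' = b + k * int (fib t)" "a' = a - k * int (fib (t - 1))"
    using level_shift[of a' t b' a b] r r' unfolding slow_rep_def by auto
  obtain l where l: "l \<ge> 0" "b = b' + l * int (fib t)"
    using level_shift[of a t b a' b'] r r' unfolding slow_rep_def by auto
  have "k * int (fib t) = 0"
    using k l by (smt (verit) mult_nonneg_nonneg of_nat_0_le_iff)
  moreover have "fib t \<noteq> 0" using r fib_neq_0_nat[of t] unfolding slow_rep_def by simp
  ultimately show ?thesis using k \<open>t' = t\<close> by simp
qed

section \<open>The term after \<open>n\<close> and its distance from
  \<open>golden * n\<close>\<close>

lemma golden_sq: "golden * golden = golden + 1"
  unfolding golden_def by (simp add: field_simps)

lemma golden_gt_1: "golden > 1"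
  unfolding golden_def by simp

text \<open>\<open>1 - golden\<close> is the conjugate root of \<open>x * x = x + 1\<close>, so both
  sides satisfy the Fibonacci recurrence, with equal values at 0 and 1.\<close>

lemma fib_Suc_golden: "real (fib (Suc m)) - golden * real (fib m) = (1 - golden) ^ m"
proof (induction m rule: fib.induct)
  case (3 m)
  have "(1 - golden) ^ Suc (Suc m) = (1 - golden) ^ Suc m + (1 - golden) ^ m"
  proof -
    have "(1 - golden) * (1 - golden) = (1 - golden) + 1"
      using golden_sq by (simp add: algebra_simps)
    then show ?thesis
      by (metis distrib_right mult.assoc mult_1 power_Suc)
  qed
  then show ?case unfolding 3[symmetric] by (simp add: algebra_simps)
qed simp_all

text \<open>This turns \<open>b \<le> int (fib t)\<close> into the estimate that keeps the rounding
  error below 1.\<close>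

lemma fib_Suc_le_golden_power: "real (fib (Suc m)) \<le> golden ^ m"
proof (induction m rule: fib.induct)
  case (3 m)
  have "golden ^ Suc (Suc m) = golden ^ Suc m + golden ^ m"
    using golden_sq by (metis distrib_right mult.assoc mult_1 power_Suc)
  then show ?case using 3 by simp
qed (use golden_gt_1 in simp_all)

lemma slow_rep_next:
  assumes "slow_rep n a b t"
  shows "fib_walk b a (t + 2) = (if even t then \<lfloor>golden * of_int n\<rfloor> else \<lceil>golden * of_int n\<rceil>)"
proof -
  from assms have t: "t \<ge> 2" and a: "1 \<le> a" "a \<le> b" "b \<le> int (fib t)"
    and n: "n = a * int (fib t) + b * int (fib (t - 1))"
    unfolding slow_rep_def by auto
  obtain m where m: "t = Suc m" using t by (cases t) auto
  define w where "w = fib_walk b a (t + 2)"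
  \<comment> \<open>\<open>q\<close> is both the reciprocal of \<open>golden\<close> and the
    negative of its conjugate: the first cancels the power of \<open>golden\<close> that bounds
    \<open>b\<close>, the second isolates the sign of the error.\<close>
  define q where "q = golden - 1"
  have q: "q * golden = 1" "0 < q"
    using golden_sq golden_gt_1 unfolding q_def by (auto simp: algebra_simps)
  have "q < 1" using q golden_gt_1 by (smt (verit) mult_left_mono mult_cancel_left2)
  define e where "e = q ^ m * (of_int b - of_int a * q)"
  have w: "w = a * int (fib (Suc t)) + b * int (fib t)"
    using fib_walk_eq[of "Suc t" b a] unfolding w_def by simp
  have "of_int w - golden * of_int n =
      of_int a * (real (fib (Suc t)) - golden * real (fib t))
      + of_int b * (real (fib (Suc m)) - golden * real (fib m))"
    unfolding w n m by (simp add: algebra_simps)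
  also have "\<dots> = (1 - golden) ^ m * (of_int b + of_int a * (1 - golden))"
    unfolding fib_Suc_golden m by (simp add: algebra_simps)
  also have "\<dots> = (- 1) ^ m * e"
  proof -
    have "1 - golden = - 1 * q" unfolding q_def by simp
    then show ?thesis unfolding e_def by (simp only: power_mult_distrib) simp
  qed
  finally have diff: "of_int w - golden * of_int n = (- 1) ^ m * e" .
  have aq: "0 < of_int a * q" "of_int a * q < of_int b"
    using a q \<open>q < 1\<close> by (simp, smt (verit) mult_less_cancel_left2 of_int_1_le_iff of_int_le_iff)
  then have e0: "e > 0" unfolding e_def using q by simp
  have "real_of_int b \<le> golden ^ m"
    using fib_Suc_le_golden_power[of m] a(3) unfolding m by linarith
  then have "of_int b - of_int a * q < golden ^ m" using aq by linarith
  then have "e < q ^ m * golden ^ m"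
    unfolding e_def using q by simp
  also have "\<dots> = 1" using q by (simp flip: power_mult_distrib)
  finally have e1: "e < 1" .
  show ?thesis
  \<comment> \<open>Since \<open>m = t - 1\<close>, the error \<open>(- 1) ^ m * e\<close> is
    negative exactly for even \<open>t\<close>; this decides between floor and ceiling.\<close>
  proof (cases "even t")
    case True
    then have "golden * of_int n = of_int w + e" using diff m by simp
    then have "\<lfloor>golden * of_int n\<rfloor> = w" using e0 e1 by (intro floor_unique) auto
    then show ?thesis using True unfolding w_def by simp
  next
    case False
    then have "golden * of_int n = of_int w - e" using diff m by simp
    then have "\<lceil>golden * of_int n\<rceil> = w" using e0 e1 by (intro ceiling_unique) auto
    then show ?thesis using False unfolding w_def by simp
  qed
qed

text \<open>The shift changes the next term by
  \<open>fib t * fib t - fib (t + 1) * fib (t - 1)\<close>, which Cassini's identity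
  evaluates.\<close>

lemma slow_rep_next_shifted:
  assumes "t \<ge> 1"
  shows "fib_walk (b + int (fib t)) (a - int (fib (t - 1))) (t + 2) =
    fib_walk b a (t + 2) + (if even t then - 1 else 1)"
proof -
  obtain m where m: "t = Suc m" using assms by (cases t) auto
  have "int (fib t) * int (fib t) - int (fib (Suc t)) * int (fib m) = (if even t then - 1 else 1)"
    using fib_Cassini_int[of m] unfolding m by (auto simp: power2_eq_square split: if_splits)
  then show ?thesis
    using fib_walk_eq[of "Suc t" b a]
      fib_walk_eq[of "Suc t" "b + int (fib t)" "a - int (fib (t - 1))"] m
    by (simp add: algebra_simps)
qed

section \<open>The list of good pairs\<close>

lemma slow_rep_n_good_cases:
  assumes rep: "slow_rep n a b t"
  shows "n_good n p \<longleftrightarrow> p = (b, a) \<or>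
    int (fib (t - 1)) < a \<and> p = (b + int (fib t), a - int (fib (t - 1)))"
proof -
  let ?f = "int (fib t)" and ?g = "int (fib (t - 1))"
  from rep have t: "t \<ge> 2" and a: "1 \<le> a" "a \<le> b" "b \<le> ?f" and n: "n = a * ?f + b * ?g"
    unfolding slow_rep_def by auto
  obtain B A where p: "p = (B, A)" by (cases p)
  \<comment> \<open>By this bound two shifts bring the coefficient down to at most
    \<open>?f - 2 * ?g \<le> 0\<close>, so at most one shift keeps it positive.\<close>
  have fg: "?f \<le> 2 * ?g"
  proof -
    obtain i where "t = Suc (Suc i)" using t by (metis add_2_eq_Suc le_Suc_ex)
    then show ?thesis using fib_mono[of i "Suc i"] by simp
  qed
  show ?thesis
  proof
    assume "n_good n p"
    then have BA: "B \<ge> 1" "A \<ge> 1" "n = A * ?f + B * ?g"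
      using slow_rep_n_good_iff[OF rep] p by auto
    then obtain k where k: "k \<ge> 0" "B = b + k * ?f" "A = a - k * ?g"
      using level_shift[of A t B a b] n t a by metis
    have "k < 2"
    proof (rule ccontr)
      assume "\<not> k < 2"
      then have "2 * ?g \<le> k * ?g" by (intro mult_right_mono) auto
      with k BA a fg show False by linarith
    qed
    then have "k = 0 \<or> k = 1" using k by linarith
    then show "p = (b, a) \<or> ?g < a \<and> p = (b + ?f, a - ?g)"
      using p k BA by auto
  next
    assume "p = (b, a) \<or> ?g < a \<and> p = (b + ?f, a - ?g)"
    then show "n_good n p"
      using slow_rep_n_good_iff[OF rep] a n by (auto simp: algebra_simps)
  qed
qed

theorem theorem1:
  fixes n :: int
  assumes "n \<ge> 2"
  shows "(\<exists>!(a, b, t). slow_rep n a b t) \<and>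
    (\<forall>a b t. slow_rep n a b t \<longrightarrow>
      (\<exists>s::nat. max_steps n = Fin s \<and> s = t + 1 \<and>
        n_good n (b, a) \<and>
        fib_walk b a (s + 1) = (if even t then \<lfloor>golden * of_int n\<rfloor> else \<lceil>golden * of_int n\<rceil>) \<and>
        (a \<le> int (fib (t - 1)) \<longrightarrow> {p. n_good n p} = {(b, a)}) \<and>
        (\<not> a \<le> int (fib (t - 1)) \<longrightarrow>
          (let b' = b + int (fib t); a' = a - int (fib (t - 1)) in
            (b', a') \<noteq> (b, a) \<and> {p. n_good n p} = {(b, a), (b', a')} \<and>
            fib_walk b' a' (s + 1) =
              (if even t then \<lfloor>golden * of_int n\<rfloor> - 1 else \<lceil>golden * of_int n\<rceil> + 1)))))"
proof (intro conjI allI impI)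
  obtain a b t where rep: "slow_rep n a b t" using slow_rep_exists[OF assms] by blast
  show "\<exists>!(a, b, t). slow_rep n a b t"
  proof (rule ex1I[of _ "(a, b, t)"])
    show "z = (a, b, t)" if "case z of (a, b, t) \<Rightarrow> slow_rep n a b t" for z
      using that slow_rep_unique[OF rep] by (cases z) auto
  qed (use rep in simp)
next
  fix a b :: int and t :: nat
  assume rep: "slow_rep n a b t"
  \<comment> \<open>Positivity of \<open>fib t\<close> makes the shifted pair differ from
    \<open>(b, a)\<close>.\<close>
  then have t: "t \<ge> 1" "fib t > 0" using fib_neq_0_nat[of t] unfolding slow_rep_def by auto
  show "\<exists>s::nat. max_steps n = Fin s \<and> s = t + 1 \<and>
        n_good n (b, a) \<and>
        fib_walk b a (s + 1) = (if even t then \<lfloor>golden * of_int n\<rfloor> else \<lceil>golden * of_int n\<rceil>) \<and>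
        (a \<le> int (fib (t - 1)) \<longrightarrow> {p. n_good n p} = {(b, a)}) \<and>
        (\<not> a \<le> int (fib (t - 1)) \<longrightarrow>
          (let b' = b + int (fib t); a' = a - int (fib (t - 1)) in
            (b', a') \<noteq> (b, a) \<and> {p. n_good n p} = {(b, a), (b', a')} \<and>
            fib_walk b' a' (s + 1) =
              (if even t then \<lfloor>golden * of_int n\<rfloor> - 1 else \<lceil>golden * of_int n\<rceil> + 1)))"
    using slow_rep_max_steps[OF rep] slow_rep_next[OF rep] slow_rep_n_good_cases[OF rep]
      slow_rep_next_shifted[OF t(1), of b a] t(2)
    by (intro exI[of _ "t + 1"]) (auto simp: Let_def simp del: fib_walk.simps)
qed

end
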